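(* Fix a sequence $(\lambda_n)$ of elements of $[0,1]$ such that (1) $\lim_{n\to\infty}\lambda_n=0$, (2) $\sum_{n=1}^\infty|\lambda_{n+1}-\lambda_n|$ converges, and (3) $\sum_{n=1}^\infty\lambda_n=\infty$. For every $\varepsilon>0$, every $M$, and every function $F:\mathbb{N}\to\mathbb{N}$, there is a $K$ such that the following holds: given a CAT(0) space $(X,d,W)$, a closed convex subset $C$ of $X$ with diameter at most $M$, a nonexpansive map $T:C\to C$ with a fixed point in $C$, and $f,u$ in $C$, if $(f_n)$ denotes the sequence of Halpern iterates corresponding to $T$, $(\lambda_n)$, $f$ and $u$, then there is an $n\le K$ such that $d(f_i,f_j)<\varepsilon$ for every $i,j\in[n,F(n)]$.
   Context: In a CAT(0) space $(X,d)$ any two points are joined by a unique geodesic; for $x,y\in X$ and $\lambda\in[0,1]$, $W(x,y,\lambda)$, also written $(1-\lambda)x+\lambda y$, denotes the unique point $z$ on the geodesic segment from $x$ to $y$ with $d(x,z)=\lambda d(x,y)$ and $d(z,y)=(1-\lambda)d(x,y)$. A subset $C$ is convex if $W(x,y,\lambda)\in C$ for all $x,y\in C$ and $\lambda\in[0,1]$. A map $T:C\to C$ is nonexpansive if $d(Tx,Ty)\le d(x,y)$ for all $x,y\in C$. The Halpern iteration corresponding to $T$, $(\lambda_n)$, $f$ and $u$ is the sequence given by $f_0=f$ and $f_{n+1}=\lambda_{n+1}u+(1-\lambda_{n+1})Tf_n$, i.e. $f_{n+1}=W(Tf_n,u,\lambda_{n+1})$. $[n,F(n)]$ denotes the set of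 integers $i$ with $n\le i\le F(n)$ (empty if $F(n)<n$). *)

theory Defs
  imports "HOL-Analysis.Analysis"
begin

definition geodesic_segment :: "'a set \<Rightarrow> ('a \<Rightarrow> 'a \<Rightarrow> real) \<Rightarrow> 'a \<Rightarrow> 'a \<Rightarrow> 'a set \<Rightarrow> bool" where
  "geodesic_segment X d x y S \<longleftrightarrow>
    (\<exists>c. c ` {0..d x y} \<subseteq> X \<and> c 0 = x \<and> c (d x y) = y \<and>
         (\<forall>s\<in>{0..d x y}. \<forall>t\<in>{0..d x y}. d (c s) (c t) = \<bar>s - t\<bar>) \<and>
         S = c ` {0..d x y})"

text \<open>
  CAT(0) spaces in the sense of comparison triangles: geodesic triangles are not fatter than
  their comparison triangles in the Euclidean plane. Any two sides of a triangle share a vertex,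
  here called \<open>p\<close>, so it is enough to compare points on the sides \<open>[p,q]\<close> and \<open>[p,r]\<close>;
  the third side enters only through its length. The primed points are the vertices \<open>p' q' r'\<close>
  of the comparison triangle and the comparison points \<open>x' y'\<close> of \<open>x\<close> and \<open>y\<close>.
  Completeness is not assumed.
\<close>

locale CAT0_space = Metric_space X d for X :: "'a set" and d :: "'a \<Rightarrow> 'a \<Rightarrow> real" +
  assumes geodesic: "\<And>x y. \<lbrakk>x \<in> X; y \<in> X\<rbrakk> \<Longrightarrow> \<exists>S. geodesic_segment X d x y S"
    and comparison:
      "\<And>p q r S S' x y (p' :: real^2) q' r' x' y'.
        \<lbrakk>p \<in> X; q \<in> X; r \<in> X;
         geodesic_segment X d p q S; geodesic_segment X d p r S'; x \<in> S; y \<in> S';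
         dist p' q' = d p q; dist p' r' = d p r; dist q' r' = d q r;
         x' \<in> closed_segment p' q'; dist p' x' = d p x;
         y' \<in> closed_segment p' r'; dist p' y' = d p y\<rbrakk>
        \<Longrightarrow> d x y \<le> dist x' y'"

definition geodesic_comb :: "'a set \<Rightarrow> ('a \<Rightarrow> 'a \<Rightarrow> real) \<Rightarrow> 'a \<Rightarrow> 'a \<Rightarrow> real \<Rightarrow> 'a" where
  "geodesic_comb X d x y t =
    (THE z. (\<exists>S. geodesic_segment X d x y S \<and> z \<in> S) \<and>
            d x z = t * d x y \<and> d z y = (1 - t) * d x y)"

definition geodesically_convex :: "'a set \<Rightarrow> ('a \<Rightarrow> 'a \<Rightarrow> real) \<Rightarrow> 'a set \<Rightarrow> bool" where
  "geodesically_convex X d C \<longleftrightarrow>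
    C \<subseteq> X \<and> (\<forall>x\<in>C. \<forall>y\<in>C. \<forall>t\<in>{0..1}. geodesic_comb X d x y t \<in> C)"

definition nonexpansive_on :: "('a \<Rightarrow> 'a \<Rightarrow> real) \<Rightarrow> 'a set \<Rightarrow> ('a \<Rightarrow> 'a) \<Rightarrow> bool" where
  "nonexpansive_on d C T \<longleftrightarrow>
    (\<forall>x\<in>C. T x \<in> C) \<and> (\<forall>x\<in>C. \<forall>y\<in>C. d (T x) (T y) \<le> d x y)"

primrec halpern ::
  "'a set \<Rightarrow> ('a \<Rightarrow> 'a \<Rightarrow> real) \<Rightarrow> ('a \<Rightarrow> 'a) \<Rightarrow> (nat \<Rightarrow> real) \<Rightarrow> 'a \<Rightarrow> 'a \<Rightarrow> nat \<Rightarrow> 'a" where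
  "halpern X d T lam f u 0 = f"
| "halpern X d T lam f u (Suc n) =
    geodesic_comb X d (T (halpern X d T lam f u n)) u (lam (Suc n))"

text \<open>
  \<open>K\<close> is a bound on the rate of metastability, uniformly in all spaces, subsets, maps and points
  such that the carrier of the space is a set of elements of type \<open>'a\<close>.

  Types cannot be quantified under \<open>\<exists>\<close>, so in \<open>\<exists>K. halpern_metastability_bound TYPE('a) lam \<epsilon> M F K\<close>
  with \<open>'a\<close> arbitrary, \<open>K\<close> could still depend on \<open>'a\<close>. That one \<open>K\<close> serves all spaces whatsoever is
  expressed by the two claims that there is a bound for \<open>TYPE(real)\<close>, and that every bound for
  \<open>TYPE(real)\<close> is also a bound for the arbitrary type \<open>'a\<close>. The type \<^typ>\<open>real\<close> is large enough as a
  reference type: closing \<open>f\<close>, \<open>u\<close> and a fixed point under \<open>T\<close> and geodesic combinations gives a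
  CAT(0) space of at most continuum size with the same Halpern iterates.
\<close>

definition halpern_metastability_bound ::
  "'a itself \<Rightarrow> (nat \<Rightarrow> real) \<Rightarrow> real \<Rightarrow> real \<Rightarrow> (nat \<Rightarrow> nat) \<Rightarrow> nat \<Rightarrow> bool" where
  "halpern_metastability_bound (_ :: 'a itself) lam \<epsilon> M F K \<longleftrightarrow>
    (\<forall>(X :: 'a set) d C T f u.
       CAT0_space X d \<longrightarrow>
       closedin (Metric_space.mtopology X d) C \<longrightarrow>
       geodesically_convex X d C \<longrightarrow>
       (\<forall>x\<in>C. \<forall>y\<in>C. d x y \<le> M) \<longrightarrow>
       nonexpansive_on d C T \<longrightarrow>
       (\<exists>p\<in>C. T p = p) \<longrightarrow>
       f \<in> C \<longrightarrow> u \<in> C \<longrightarrow>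
       (\<exists>n\<le>K. \<forall>i\<in>{n..F n}. \<forall>j\<in>{n..F n}.
          d (halpern X d T lam f u i) (halpern X d T lam f u j) < \<epsilon>))"

end

theory Submission
  imports Defs
begin

text \<open>
  By the recursion for \<open>d (f\<^bsub>n+1\<^esub>, f\<^sub>n)\<close>, the iterates are approximate fixed points from some index
  on that depends only on \<open>M\<close> and \<open>lam\<close>. The CN inequality gives
  \<open>d(f\<^bsub>n+1\<^esub>, p)\<^sup>2 \<le> (1 - \<lambda>) d(T f\<^sub>n, p)\<^sup>2 + \<lambda> (d(u, p)\<^sup>2 - (1 - \<lambda>) d(u, T f\<^sub>n)\<^sup>2)\<close>,
  so \<open>f\<^sub>n\<close> gets close to an approximate fixed point \<open>p\<close> as soon as \<open>p\<close> almost minimises the distance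
  to \<open>u\<close> among the approximate fixed points. The quality demanded of \<open>p\<close> depends on the end \<open>F N\<close> of
  the window, while \<open>N\<close> depends on the tolerance \<open>\<delta>\<close> up to which the iterates are fixed by \<open>T\<close>; this yields a
  sequence of tolerances \<open>\<delta>\<^bsub>j+1\<^esub> = \<phi> \<delta>\<^sub>j\<close>. The minimal squared distances at these tolerances
  lie in \<open>[0, M\<^sup>2]\<close>, so within a number of stages that depends only on \<open>\<epsilon>\<close> and \<open>M\<close> some step
  increases them only slightly, and the iterates are then close to \<open>p\<close> throughout \<open>[N, F N]\<close>.
\<close>

section \<open>Geometry of CAT(0) spaces\<close>

text \<open>With one vertex at the origin and \<open>q\<close> on the first axis, the law of cosines
  dictates the first coordinate \<open>x\<close> of \<open>r\<close>. The triangle inequalities give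
  \<open>\<bar>x\<bar> \<le> b\<close>, so a real second coordinate exists.\<close>

lemma euclidean_triangle_exists:
  fixes a b c :: real
  assumes "0 \<le> a" "0 \<le> b" "0 \<le> c" "a \<le> b + c" "b \<le> a + c" "c \<le> a + b"
  obtains q r :: "real^2" where "norm q = a" "norm r = b" "dist q r = c"
proof (cases "a = 0")
  case True
  show ?thesis
    by (rule that[of 0 "vector [b, 0]"])
      (use True assms in \<open>auto simp: dist_norm norm_vec_def L2_set_def sum_2\<close>)
next
  case False
  define x where "x = (a\<^sup>2 + b\<^sup>2 - c\<^sup>2) / (2 * a)"
  define y where "y = sqrt (b\<^sup>2 - x\<^sup>2)"
  have a: "a > 0" using False assms by simp
  have x: "2 * a * x = a\<^sup>2 + b\<^sup>2 - c\<^sup>2" using a by (simp add: x_def)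
  have "(a - b)\<^sup>2 \<le> c\<^sup>2" by (rule power2_le_iff_abs_le[THEN iffD2]) (use assms in auto)
  moreover have "c\<^sup>2 \<le> (a + b)\<^sup>2" by (rule power_mono) (use assms in auto)
  ultimately have "2 * a * x \<le> 2 * a * b" "2 * a * (- b) \<le> 2 * a * x"
    unfolding x by (auto simp: power2_eq_square algebra_simps)
  hence "a * x \<le> a * b" "a * (- b) \<le> a * x" by auto
  hence "x \<le> b" "- b \<le> x" using a mult_left_le_imp_le by blast+
  hence "\<bar>x\<bar> \<le> b" by simp
  hence "x\<^sup>2 \<le> b\<^sup>2" using power2_le_iff_abs_le assms by blast
  hence y: "y\<^sup>2 = b\<^sup>2 - x\<^sup>2" by (simp add: y_def)
  have "(a - x)\<^sup>2 + (0 - y)\<^sup>2 = c\<^sup>2"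
    using x y by (simp add: power2_eq_square algebra_simps)
  moreover have "dist (vector [a, 0]) (vector [x, y] :: real^2) = sqrt ((a - x)\<^sup>2 + (0 - y)\<^sup>2)"
    by (simp add: dist_vec_def L2_set_def sum_2 dist_real_def)
  ultimately have "dist (vector [a, 0]) (vector [x, y] :: real^2) = c" using assms by simp
  moreover have "norm (vector [a, 0] :: real^2) = a" "norm (vector [x, y] :: real^2) = b"
    using a assms y by (auto simp: norm_vec_def L2_set_def sum_2)
  ultimately show ?thesis using that by blast
qed

section \<open>Geodesic combinations and their metric inequalities\<close>

context CAT0_space
begin

lemma geodesic_segment_mem:
  assumes "geodesic_segment X d x y S" "z \<in> S"
  shows "z \<in> X" "d x z \<le> d x y" "d z y = d x y - d x z"
proof -
  obtain c where c: "c ` {0..d x y} \<subseteq> X" "c 0 = x" "c (d x y) = y"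
      "\<forall>s\<in>{0..d x y}. \<forall>t\<in>{0..d x y}. d (c s) (c t) = \<bar>s - t\<bar>" "S = c ` {0..d x y}"
    using assms(1) unfolding geodesic_segment_def by blast
  obtain s where s: "s \<in> {0..d x y}" "z = c s" using assms(2) c(5) by blast
  show "z \<in> X" using s c(1) by blast
  have "d (c 0) (c s) = \<bar>0 - s\<bar>" "d (c s) (c (d x y)) = \<bar>s - d x y\<bar>"
    using c(4) s(1) by (meson atLeastAtMost_iff nonneg order_refl)+
  hence "d x z = s" "d z y = d x y - s" using c s by auto
  thus "d x z \<le> d x y" "d z y = d x y - d x z" using s by auto
qed

lemma geodesic_segment_point:
  assumes "geodesic_segment X d x y S" "t \<in> {0..1}"
  obtains z where "z \<in> S" "d x z = t * d x y"
proof -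
  obtain c where c: "c 0 = x" 
      "\<forall>s\<in>{0..d x y}. \<forall>t\<in>{0..d x y}. d (c s) (c t) = \<bar>s - t\<bar>" "S = c ` {0..d x y}"
    using assms(1) unfolding geodesic_segment_def by blast
  have t: "t * d x y \<in> {0..d x y}" using assms(2) by (auto intro: mult_left_le_one_le)
  moreover have "d (c 0) (c (t * d x y)) = \<bar>0 - t * d x y\<bar>" using c(2) t by force
  ultimately show ?thesis using that[of "c (t * d x y)"] c assms(2) by auto
qed

lemma geodesic_segment_commute:
  assumes "geodesic_segment X d x y S"
  shows "geodesic_segment X d y x S"
proof -
  obtain c where c: "c ` {0..d x y} \<subseteq> X" "c 0 = x" "c (d x y) = y"
      "\<forall>s\<in>{0..d x y}. \<forall>t\<in>{0..d x y}. d (c s) (c t) = \<bar>s - t\<bar>" "S = c ` {0..d x y}"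
    using assms unfolding geodesic_segment_def by blast
  have "(\<lambda>s. c (d x y - s)) ` {0..d x y} = c ` {0..d x y}"
    by (simp add: image_image[symmetric, of c "\<lambda>s. d x y - s"])
  moreover have "\<forall>s\<in>{0..d x y}. \<forall>t\<in>{0..d x y}. d (c (d x y - s)) (c (d x y - t)) = \<bar>s - t\<bar>"
    using c(4) by (auto simp: abs_minus_commute)
  ultimately show ?thesis
    unfolding geodesic_segment_def commute[of y x]
    by (intro exI[of _ "\<lambda>s. c (d x y - s)"]) (use c in auto)
qed

text \<open>Putting the common vertex of the comparison triangle at the origin turns comparison
  points into scalar multiples, so later estimates become computations with norms.\<close>

lemma comparison_scaled:
  fixes q' r' :: "real^2"
  assumes "p \<in> X" "q \<in> X" "r \<in> X"
    and "geodesic_segment X d p q S" "x \<in> S" "d p x = s * d p q" "s \<in> {0..1}"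
    and "geodesic_segment X d p r S'" "y \<in> S'" "d p y = t * d p r" "t \<in> {0..1}"
    and "norm q' = d p q" "norm r' = d p r" "dist q' r' = d q r"
  shows "d x y \<le> norm (s *\<^sub>R q' - t *\<^sub>R r')"
  unfolding dist_norm[symmetric]
  by (rule comparison[of p q r S S' x y 0 q' r'])
    (use assms in \<open>auto simp: closed_segment_def intro: exI[of _ s] exI[of _ t]\<close>)

text \<open>Justifies the definite description in \<open>geodesic_comb\<close>: whichever geodesic a
  point at the right distance lies on, it is the same point.\<close>

lemma geodesic_comb_eqI:
  assumes "x \<in> X" "y \<in> X" "geodesic_segment X d x y S" "z \<in> S" "d x z = t * d x y" "t \<in> {0..1}"
  shows "geodesic_comb X d x y t = z"
  unfolding geodesic_comb_def
proof (rule the_equality)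
  show "(\<exists>S. geodesic_segment X d x y S \<and> z \<in> S) \<and> d x z = t * d x y \<and> d z y = (1 - t) * d x y"
    using assms geodesic_segment_mem[of x y S z] by (auto simp: algebra_simps)
next
  fix w
  assume "(\<exists>S. geodesic_segment X d x y S \<and> w \<in> S) \<and> d x w = t * d x y \<and> d w y = (1 - t) * d x y"
  then obtain S' where w: "geodesic_segment X d x y S'" "w \<in> S'" "d x w = t * d x y" by blast
  \<comment> \<open>The triangle \<open>x, y, y\<close> is degenerate. Its two long comparison sides
    coincide, so points at the same fraction along two geodesics have distance
    \<open>0\<close>.\<close>
  obtain q' r' :: "real^2" where q: "norm q' = d x y" "norm r' = d x y" "dist q' r' = d y y"
    by (rule euclidean_triangle_exists[of "d x y" "d x y" "d y y"]) (use assms in auto)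
  have "d w z \<le> norm (t *\<^sub>R q' - t *\<^sub>R r')"
    by (rule comparison_scaled[of x y y S' w t S z t]) (use assms w q in auto)
  also have "\<dots> = 0" using q(3) assms by simp
  finally show "w = z"
    using geodesic_segment_mem(1)[OF w(1,2)] geodesic_segment_mem(1)[OF assms(3,4)]
    by (metis nonneg order_antisym zero)
qed

lemma geodesic_combE:
  assumes "x \<in> X" "y \<in> X" "t \<in> {0..1}"
  obtains S where "geodesic_segment X d x y S" "geodesic_comb X d x y t \<in> S"
    "d x (geodesic_comb X d x y t) = t * d x y"
proof -
  obtain S where S: "geodesic_segment X d x y S" using geodesic assms by blast
  obtain z where z: "z \<in> S" "d x z = t * d x y" using geodesic_segment_point[OF S assms(3)] .
  have "geodesic_comb X d x y t = z" by (rule geodesic_comb_eqI[OF assms(1,2) S z assms(3)])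
  thus ?thesis using that S z by blast
qed

lemma geodesic_comb_in: "\<lbrakk>x \<in> X; y \<in> X; t \<in> {0..1}\<rbrakk> \<Longrightarrow> geodesic_comb X d x y t \<in> X"
  by (meson geodesic_combE geodesic_segment_mem(1))

lemma dist_geodesic_comb:
  assumes "x \<in> X" "y \<in> X" "t \<in> {0..1}"
  shows "d x (geodesic_comb X d x y t) = t * d x y"
  using geodesic_combE[OF assms] by blast

lemma geodesic_comb_commute:
  assumes "x \<in> X" "y \<in> X" "t \<in> {0..1}"
  shows "geodesic_comb X d x y t = geodesic_comb X d y x (1 - t)"
proof -
  obtain S where S: "geodesic_segment X d x y S" "geodesic_comb X d x y t \<in> S"
    "d x (geodesic_comb X d x y t) = t * d x y" using geodesic_combE[OF assms] .
  have "d y (geodesic_comb X d x y t) = (1 - t) * d y x"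
    using geodesic_segment_mem(3)[OF S(1,2)] S(3) by (simp add: commute[of y] algebra_simps)
  thus ?thesis
    by (intro geodesic_comb_eqI[symmetric, OF _ _ geodesic_segment_commute[OF S(1)] S(2)])
       (use assms in auto)
qed

lemma geodesic_comb_1: "\<lbrakk>x \<in> X; y \<in> X\<rbrakk> \<Longrightarrow> geodesic_comb X d x y 1 = y"
  using dist_geodesic_comb[of y x 0] geodesic_comb_commute[of x y 1] geodesic_comb_in[of y x 0]
  by auto

lemma comparison_triangle_exists:
  assumes "p \<in> X" "q \<in> X" "r \<in> X"
  obtains q' r' :: "real^2" where "norm q' = d p q" "norm r' = d p r" "dist q' r' = d q r"
  by (rule euclidean_triangle_exists[of "d p q" "d p r" "d q r"])
    (use assms triangle[of p r q] triangle[of p q r] triangle[of q p r] in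
      \<open>auto simp: commute[of r q] commute[of q p]\<close>)

lemma dist_geodesic_comb_comb:
  fixes q' r' :: "real^2"
  assumes "p \<in> X" "q \<in> X" "r \<in> X" "s \<in> {0..1}" "t \<in> {0..1}"
    and "norm q' = d p q" "norm r' = d p r" "dist q' r' = d q r"
  shows "d (geodesic_comb X d p q s) (geodesic_comb X d p r t) \<le> norm (s *\<^sub>R q' - t *\<^sub>R r')"
proof -
  obtain S S' where "geodesic_segment X d p q S" "geodesic_comb X d p q s \<in> S"
    "d p (geodesic_comb X d p q s) = s * d p q"
    "geodesic_segment X d p r S'" "geodesic_comb X d p r t \<in> S'"
    "d p (geodesic_comb X d p r t) = t * d p r"
    using geodesic_combE[of p q s] geodesic_combE[of p r t] assms by metis
  thus ?thesis using comparison_scaled[of p q r S _ s S' _ t q' r'] assms by blast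
qed

lemma dist_geodesic_comb_same:
  assumes "x \<in> X" "y \<in> X" "s \<in> {0..1}" "t \<in> {0..1}"
  shows "d (geodesic_comb X d x y s) (geodesic_comb X d x y t) \<le> \<bar>s - t\<bar> * d x y"
proof -
  obtain q' r' :: "real^2" where q: "norm q' = d x y" "norm r' = d x y" "dist q' r' = d y y"
    using comparison_triangle_exists[of x y y] assms by blast
  hence "r' = q'" using assms by simp
  thus ?thesis
    using dist_geodesic_comb_comb[OF assms(1,2,2,3,4) q] q
    by (simp add: scaleR_left_diff_distrib[symmetric])
qed

text \<open>Comparison needs a common initial vertex, so both segments are reversed to start at
  \<open>u\<close>; the Euclidean triangle then shrinks by the factor \<open>1 - t\<close>.\<close>

lemma dist_geodesic_comb_contract:
  assumes "x \<in> X" "y \<in> X" "u \<in> X" "t \<in> {0..1}"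
  shows "d (geodesic_comb X d x u t) (geodesic_comb X d y u t) \<le> (1 - t) * d x y"
proof -
  obtain q' r' :: "real^2" where q: "norm q' = d u x" "norm r' = d u y" "dist q' r' = d x y"
    using comparison_triangle_exists[of u x y] assms by blast
  have "d (geodesic_comb X d u x (1 - t)) (geodesic_comb X d u y (1 - t)) \<le>
      norm ((1 - t) *\<^sub>R q' - (1 - t) *\<^sub>R r')"
    by (rule dist_geodesic_comb_comb) (use assms q in auto)
  also have "\<dots> = (1 - t) * d x y"
    using q(3) assms(4) by (simp add: scaleR_right_diff_distrib[symmetric] dist_norm)
  finally show ?thesis using assms by (simp add: geodesic_comb_commute[of _ u])
qed

text \<open>Entering \<open>w\<close> as the endpoint \<open>geodesic_comb X d x w 1\<close>
  compares a point of one side with the opposite vertex; what remains is Stewart's identity in the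
  plane.\<close>

lemma CN_inequality:
  assumes "x \<in> X" "y \<in> X" "w \<in> X" "t \<in> {0..1}"
  shows "(d (geodesic_comb X d x y t) w)\<^sup>2 \<le>
    (1 - t) * (d x w)\<^sup>2 + t * (d y w)\<^sup>2 - t * (1 - t) * (d x y)\<^sup>2"
proof -
  obtain q' r' :: "real^2" where q: "norm q' = d x y" "norm r' = d x w" "dist q' r' = d y w"
    using comparison_triangle_exists[of x y w] assms by blast
  have "d (geodesic_comb X d x y t) (geodesic_comb X d x w 1) \<le> norm (t *\<^sub>R q' - 1 *\<^sub>R r')"
    by (rule dist_geodesic_comb_comb) (use assms q in auto)
  hence "(d (geodesic_comb X d x y t) w)\<^sup>2 \<le> (norm (t *\<^sub>R q' - r'))\<^sup>2"
    using assms by (intro power_mono) (auto simp: geodesic_comb_1)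
  also have "\<dots> = (1 - t) * (norm r')\<^sup>2 + t * (dist q' r')\<^sup>2 - t * (1 - t) * (norm q')\<^sup>2"
    unfolding power2_norm_eq_inner dist_norm
    by (simp add: inner_diff_left inner_diff_right inner_commute algebra_simps)
  finally show ?thesis by (simp add: q)
qed

end

section \<open>Metastability of the Halpern iteration\<close>

text \<open>By \<open>1 - l \<le> exp (- l)\<close> the product is at most the exponential of minus
  the sum of the weights after \<open>m\<close>, and that sum diverges.\<close>

lemma prod_one_minus_tendsto_0:
  fixes lam :: "nat \<Rightarrow> real"
  assumes "\<forall>n. lam n \<in> {0..1}" "filterlim (\<lambda>N. \<Sum>n=1..N. lam n) at_top at_top"
  shows "(\<lambda>n. \<Prod>k\<in>{m<..n}. 1 - lam k) \<longlonglongrightarrow> 0"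
proof (rule tendsto_sandwich[OF _ _ tendsto_const])
  define S where "S n = (\<Sum>k=1..n. lam k)" for n
  show "\<forall>\<^sub>F n in sequentially. 0 \<le> (\<Prod>k\<in>{m<..n}. 1 - lam k)"
    using assms(1) by (intro always_eventually allI prod_nonneg) auto
  have "(\<Prod>k\<in>{m<..n}. 1 - lam k) \<le> exp (S m - S n)" if "m \<le> n" for n
  proof -
    have "(\<Prod>k\<in>{m<..n}. 1 - lam k) \<le> (\<Prod>k\<in>{m<..n}. exp (- lam k))"
      using assms(1) exp_ge_add_one_self[of "- lam k" for k] by (intro prod_mono) auto
    also have "\<dots> = exp (- (\<Sum>k\<in>{m<..n}. lam k))" by (simp add: exp_sum sum_negf[symmetric])
    also have "S n = S m + (\<Sum>k\<in>{m<..n}. lam k)"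
    proof -
      have "{1..n} = {1..m} \<union> {m<..n}" "{1..m} \<inter> {m<..n} = {}" using that by auto
      thus ?thesis unfolding S_def using sum.union_disjoint[of "{1..m}" "{m<..n}" lam] by simp
    qed
    hence "- (\<Sum>k\<in>{m<..n}. lam k) = S m - S n" by simp
    finally show ?thesis .
  qed
  thus "\<forall>\<^sub>F n in sequentially. (\<Prod>k\<in>{m<..n}. 1 - lam k) \<le> exp (S m - S n)"
    unfolding eventually_sequentially by blast
  have "filterlim (\<lambda>n. - S n) at_bot sequentially"
    using assms(2) by (simp add: filterlim_uminus_at_top S_def)
  hence "filterlim (\<lambda>n. S m - S n) at_bot sequentially"
    using filterlim_tendsto_add_at_bot_iff[OF tendsto_const[of "S m"], of "\<lambda>n. - S n"]
    by simp
  thus "(\<lambda>n. exp (S m - S n)) \<longlonglongrightarrow> 0"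
    by (rule filterlim_compose[OF exp_at_bot])
qed

text \<open>Unrolling damps the initial value by the product, the averages with \<open>B\<close>
  contribute at most \<open>B\<close> in total, and the errors add up undamped. It serves the
  successive distances (with \<open>B = 0\<close>) and the squared distances to an approximate fixed
  point (with constant \<open>e\<close>).\<close>

lemma relaxed_recursion_bound:
  fixes s lam e :: "nat \<Rightarrow> real"
  assumes "m \<le> n" "\<forall>n. lam n \<in> {0..1}" "0 \<le> B" "\<And>k. m \<le> k \<Longrightarrow> 0 \<le> e k"
    and "\<And>k. m \<le> k \<Longrightarrow> s (Suc k) \<le> (1 - lam (Suc k)) * s k + lam (Suc k) * B + e k"
  shows "s n \<le> (\<Prod>k\<in>{m<..n}. 1 - lam k) * s m + B + (\<Sum>k\<in>{m..<n}. e k)"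
  using assms(1)
proof (induction n rule: dec_induct)
  case base
  thus ?case using assms by simp
next
  case (step n)
  let ?P = "\<Prod>k\<in>{m<..n}. 1 - lam k" and ?E = "\<Sum>k\<in>{m..<n}. e k"
  have lam: "0 \<le> lam (Suc n)" "lam (Suc n) \<le> 1" using assms(2) by auto
  have E: "0 \<le> ?E" using assms(4) by (intro sum_nonneg) auto
  have "{m<..Suc n} = insert (Suc n) {m<..n}" using step by auto
  hence P: "(\<Prod>k\<in>{m<..Suc n}. 1 - lam k) = (1 - lam (Suc n)) * ?P" by simp
  have "s (Suc n) \<le> (1 - lam (Suc n)) * s n + lam (Suc n) * B + e n"
    using assms(5) step by simp
  also have "\<dots> \<le> (1 - lam (Suc n)) * (?P * s m + B + ?E) + lam (Suc n) * B + e n"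
    using step lam by (intro add_mono mult_left_mono) auto
  also have "\<dots> = (1 - lam (Suc n)) * ?P * s m + B + ?E + e n - lam (Suc n) * ?E"
    by (simp add: algebra_simps)
  also have "\<dots> \<le> (1 - lam (Suc n)) * ?P * s m + B + (?E + e n)" using lam E by simp
  finally show ?case using P step by simp
qed

text \<open>If each of the first \<open>k\<close> steps rose by more than \<open>e\<close>, then
  \<open>a k\<close> would exceed \<open>b\<close>. The number \<open>k\<close> does not depend on
  the sequence, which keeps the final bound uniform.\<close>

lemma bounded_almost_nonincreasing:
  fixes a :: "nat \<Rightarrow> real"
  assumes "\<And>j. 0 \<le> a j" "\<And>j. a j \<le> b" "0 < e" "b < real k * e"
  obtains j where "j < k" "a (Suc j) \<le> a j + e"
proof -
  have "\<exists>j<k. a (Suc j) \<le> a j + e"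
  proof (rule ccontr)
    assume "\<not> ?thesis"
    hence step: "a j + e < a (Suc j)" if "j < k" for j using that by force
    have "real i * e \<le> a i" if "i \<le> k" for i
      using that
    proof (induction i)
      case (Suc i)
      thus ?case using step[of i] by (simp add: algebra_simps)
    qed (use assms in simp)
    from this[of k] show False using assms(2)[of k] assms(4) by simp
  qed
  thus ?thesis using that by blast
qed

section \<open>Estimates for a single iteration\<close>

text \<open>The locale predicate can be quantified over: later statements choose their bounds first
  and let the space, the map and the points vary afterwards.\<close>

locale halpern_iteration = CAT0_space X d for X :: "'a set" and d +
  fixes C :: "'a set" and T :: "'a \<Rightarrow> 'a" and lam :: "nat \<Rightarrow> real" and f u :: 'a and M :: real
  assumes C_convex: "geodesically_convex X d C"
    and C_diameter: "\<And>x y. \<lbrakk>x \<in> C; y \<in> C\<rbrakk> \<Longrightarrow> d x y \<le> M"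
    and T_nonexpansive: "nonexpansive_on d C T"
    and lam: "lam n \<in> {0..1}"
    and start: "f \<in> C" "u \<in> C"
begin

abbreviation x :: "nat \<Rightarrow> 'a" where "x \<equiv> halpern X d T lam f u"

lemma C_subset: "y \<in> C \<Longrightarrow> y \<in> X"
  using C_convex by (auto simp: geodesically_convex_def)

lemma T_in: "y \<in> C \<Longrightarrow> T y \<in> C"
  and T_dist: "y \<in> C \<Longrightarrow> z \<in> C \<Longrightarrow> d (T y) (T z) \<le> d y z"
  using T_nonexpansive by (auto simp: nonexpansive_on_def)

lemma x_in: "x n \<in> C"
proof (induction n)
  case (Suc n)
  thus ?case using start lam[of "Suc n"] C_convex T_in[OF Suc]
    unfolding geodesically_convex_def by auto
qed (use start in simp)

lemma M_nonneg: "0 \<le> M"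
  using order_trans[OF nonneg C_diameter[OF start(1) start(1)]] .

lemma lam_bounds: "0 \<le> lam n" "lam n \<le> 1" using lam by auto

lemmas in_X = x_in[THEN C_subset] T_in[OF x_in, THEN C_subset] start[THEN C_subset]

lemma successive_dist:
  "d (x (Suc (Suc n))) (x (Suc n)) \<le>
    (1 - lam (Suc (Suc n))) * d (x (Suc n)) (x n) + M * \<bar>lam (Suc (Suc n)) - lam (Suc n)\<bar>"
proof -
  \<comment> \<open>\<open>?y\<close> combines the earlier point with the later weight, so one leg
    of the triangle changes only the point and the other only the weight.\<close>
  let ?y = "geodesic_comb X d (T (x n)) u (lam (Suc (Suc n)))"
  have "d (x (Suc (Suc n))) ?y \<le> (1 - lam (Suc (Suc n))) * d (T (x (Suc n))) (T (x n))"
    unfolding halpern.simps(2)[of _ _ _ _ _ _ "Suc n"]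
    by (intro dist_geodesic_comb_contract in_X lam)
  also have "\<dots> \<le> (1 - lam (Suc (Suc n))) * d (x (Suc n)) (x n)"
    using lam_bounds by (intro mult_left_mono T_dist x_in) auto
  finally have 1: "d (x (Suc (Suc n))) ?y \<le> (1 - lam (Suc (Suc n))) * d (x (Suc n)) (x n)" .
  have "d ?y (x (Suc n)) \<le> \<bar>lam (Suc (Suc n)) - lam (Suc n)\<bar> * d (T (x n)) u"
    unfolding halpern.simps(2)[of _ _ _ _ _ _ n]
    by (intro dist_geodesic_comb_same in_X lam)
  also have "\<dots> \<le> \<bar>lam (Suc (Suc n)) - lam (Suc n)\<bar> * M"
    using C_diameter T_in x_in start by (intro mult_left_mono) auto
  finally have 2: "d ?y (x (Suc n)) \<le> M * \<bar>lam (Suc (Suc n)) - lam (Suc n)\<bar>"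
    by (simp add: mult.commute)
  have "?y \<in> X" by (intro geodesic_comb_in in_X lam)
  thus ?thesis using triangle[OF in_X(1) _ in_X(1), of ?y "Suc (Suc n)" "Suc n"] 1 2 by linarith
qed

text \<open>The estimate goes through \<open>x (Suc n)\<close>, which lies at the fraction
  \<open>lam (Suc n)\<close> of the way from \<open>T (x n)\<close> to \<open>u\<close>.\<close>

lemma dist_T_x: "d (T (x n)) (x n) \<le> d (x (Suc n)) (x n) + lam (Suc n) * M"
proof -
  have "d (T (x n)) (x (Suc n)) = lam (Suc n) * d (T (x n)) u"
    unfolding halpern.simps(2) by (intro dist_geodesic_comb in_X lam)
  also have "\<dots> \<le> lam (Suc n) * M"
    using lam_bounds C_diameter T_in x_in start by (intro mult_left_mono) auto
  finally show ?thesis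
    using triangle[OF in_X(2)[of n] in_X(1)[of "Suc n"] in_X(1)[of n]] by linarith
qed

lemma dist_T_x_bound:
  assumes "1 \<le> m" "m \<le> n"
  shows "d (T (x n)) (x n) \<le> (\<Prod>k\<in>{m<..Suc n}. 1 - lam k) * M
    + M * (\<Sum>k\<in>{m..n}. \<bar>lam (Suc k) - lam k\<bar>) + lam (Suc n) * M"
proof -
  let ?P = "\<Prod>k\<in>{m<..Suc n}. 1 - lam k"
  have "d (x (Suc n)) (x (Suc n - 1)) \<le> ?P * d (x m) (x (m - 1)) + 0
      + (\<Sum>k\<in>{m..<Suc n}. M * \<bar>lam (Suc k) - lam k\<bar>)"
  \<comment> \<open>The shift by one matches the factor \<open>1 - lam (Suc k)\<close> of the
    recursion; \<open>1 \<le> m\<close> ensures that \<open>k - 1\<close> is a genuine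
    predecessor.\<close>
  proof (rule relaxed_recursion_bound[where s = "\<lambda>n. d (x n) (x (n - 1))"])
    fix k assume "m \<le> k"
    then obtain i where "k = Suc i" using assms by (cases k) auto
    thus "d (x (Suc k)) (x (Suc k - 1)) \<le> (1 - lam (Suc k)) * d (x k) (x (k - 1))
      + lam (Suc k) * 0 + M * \<bar>lam (Suc k) - lam k\<bar>" using successive_dist[of i] by simp
  qed (use assms lam M_nonneg in auto)
  moreover have "?P * d (x m) (x (m - 1)) \<le> ?P * M"
    using lam_bounds C_diameter x_in by (intro mult_left_mono prod_nonneg) auto
  ultimately show ?thesis
    using dist_T_x[of n] by (simp add: sum_distrib_left atLeastLessThanSuc_atLeastAtMost)
qed

text \<open>\<open>proj\<close> says that, in squared distance and up to \<open>2 * e\<close>,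
  \<open>p\<close> is no farther from \<open>u\<close> than the points \<open>T (x k)\<close>; this
  bounds the term that CN multiplies by \<open>lam\<close>. The defect \<open>\<eta>\<close> of
  \<open>p\<close> costs at most \<open>(2 * M + 1) * \<eta>\<close> per step, so the estimate is
  useful only up to an index known in advance.\<close>

lemma dist_sq_approx_fixed_point:
  assumes p: "p \<in> C" "d p (T p) \<le> \<eta>" "\<eta> \<le> 1"
    and mn: "m \<le> n" and e: "0 \<le> e"
    and lam_small: "\<And>k. m \<le> k \<Longrightarrow> lam k * M\<^sup>2 \<le> e"
    and proj: "\<And>k. m \<le> k \<Longrightarrow> (d u p)\<^sup>2 \<le> (d u (T (x k)))\<^sup>2 + 2 * e"
  shows "(d (x n) p)\<^sup>2 \<le> (\<Prod>k\<in>{m<..n}. 1 - lam k) * M\<^sup>2 + 3 * e + n * ((2 * M + 1) * \<eta>)"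
proof -
  have \<eta>: "0 \<le> \<eta>" using p(2) nonneg[of p "T p"] by linarith
  have pX: "p \<in> X" "T p \<in> X" using p C_subset T_in by auto
  have "(d (x n) p)\<^sup>2 \<le> (\<Prod>k\<in>{m<..n}. 1 - lam k) * (d (x m) p)\<^sup>2 + 3 * e
    + (\<Sum>k\<in>{m..<n}. (2 * M + 1) * \<eta>)"
  proof (rule relaxed_recursion_bound[where s = "\<lambda>n. (d (x n) p)\<^sup>2"])
    fix k assume k: "m \<le> k"
    let ?l = "lam (Suc k)" and ?a = "d (x k) p" and ?b = "d u (T (x k))"
    have "d (T (x k)) p \<le> d (T (x k)) (T p) + d (T p) p"
      using triangle[OF in_X(2) pX(2) pX(1)] .
    also have "\<dots> \<le> ?a + \<eta>" using T_dist x_in p by (intro add_mono) (auto simp: commute[of "T p"])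
    finally have "(d (T (x k)) p)\<^sup>2 \<le> (?a + \<eta>)\<^sup>2" by (intro power_mono) auto
    also have "\<dots> = ?a\<^sup>2 + (2 * ?a + \<eta>) * \<eta>" by (simp add: power2_eq_square algebra_simps)
    also have "\<dots> \<le> ?a\<^sup>2 + (2 * M + 1) * \<eta>"
      using C_diameter x_in p \<eta> by (intro add_mono mult_right_mono) auto
    finally have Tx: "(d (T (x k)) p)\<^sup>2 \<le> ?a\<^sup>2 + (2 * M + 1) * \<eta>" .
    have "?b\<^sup>2 \<le> M\<^sup>2" using C_diameter T_in x_in start by (intro power_mono) auto
    hence "?l * ?b\<^sup>2 \<le> ?l * M\<^sup>2" using lam_bounds by (intro mult_left_mono) auto
    \<comment> \<open>The left side splits into \<open>(d u p)\<^sup>2 - ?b\<^sup>2\<close>, at most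
      \<open>2 * e\<close>, and \<open>?l * ?b\<^sup>2\<close>, at most \<open>e\<close>.\<close>
    hence l: "(d u p)\<^sup>2 - (1 - ?l) * ?b\<^sup>2 \<le> 3 * e"
      using lam_small[of "Suc k"] proj[OF k] k by (simp add: algebra_simps)
    have "(d (x (Suc k)) p)\<^sup>2 \<le> (1 - ?l) * (d (T (x k)) p)\<^sup>2 + ?l * (d u p)\<^sup>2
        - ?l * (1 - ?l) * (d (T (x k)) u)\<^sup>2"
      unfolding halpern.simps(2) by (intro CN_inequality in_X pX lam)
    also have "\<dots> = (1 - ?l) * (d (T (x k)) p)\<^sup>2 + ?l * ((d u p)\<^sup>2 - (1 - ?l) * ?b\<^sup>2)"
      by (simp add: commute[of "T (x k)"] algebra_simps)
    also have "\<dots> \<le> (1 - ?l) * (?a\<^sup>2 + (2 * M + 1) * \<eta>) + ?l * (3 * e)"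
      using Tx l lam_bounds by (intro add_mono mult_left_mono) auto
    also have "\<dots> \<le> (1 - ?l) * ?a\<^sup>2 + ?l * (3 * e) + (2 * M + 1) * \<eta>"
      using lam_bounds M_nonneg \<eta> by (simp add: algebra_simps)
    finally show "(d (x (Suc k)) p)\<^sup>2 \<le> (1 - ?l) * ?a\<^sup>2 + ?l * (3 * e) + (2 * M + 1) * \<eta>" .
  qed (use mn lam e M_nonneg \<eta> in auto)
  also have "(\<Prod>k\<in>{m<..n}. 1 - lam k) * (d (x m) p)\<^sup>2 \<le> (\<Prod>k\<in>{m<..n}. 1 - lam k) * M\<^sup>2"
    using lam_bounds C_diameter[OF x_in p(1)]
    by (intro mult_left_mono prod_nonneg power_mono) auto
  also have "(\<Sum>k\<in>{m..<n}. (2 * M + 1) * \<eta>) \<le> n * ((2 * M + 1) * \<eta>)"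
    using M_nonneg \<eta> by (simp add: mult_right_mono)
  finally show ?thesis by simp
qed

end

section \<open>Bounds uniform over all spaces, maps and points\<close>

lemma uniform_asymptotic_regularity:
  fixes lam :: "nat \<Rightarrow> real" and M \<delta> :: real
  assumes lam: "\<forall>n. lam n \<in> {0..1}" "lam \<longlonglongrightarrow> 0"
    "convergent (\<lambda>N. \<Sum>n=1..N. \<bar>lam (n + 1) - lam n\<bar>)"
    "filterlim (\<lambda>N. \<Sum>n=1..N. lam n) at_top at_top"
    and M: "0 \<le> M" and \<delta>: "0 < \<delta>"
  shows "\<exists>m. \<forall>n\<ge>m. \<forall>X d C T (f :: 'a) u. halpern_iteration X d C T lam f u M \<longrightarrow>
    d (T (halpern X d T lam f u n)) (halpern X d T lam f u n) \<le> \<delta>"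
proof -
  define S where "S N = (\<Sum>n=1..N. \<bar>lam (Suc n) - lam n\<bar>)" for N
  \<comment> \<open>Each of the three terms of \<open>dist_T_x_bound\<close> will be at most
    \<open>M * \<gamma>\<close>; \<open>M + 1\<close> covers the case \<open>M = 0\<close>.\<close>
  define \<gamma> where "\<gamma> = \<delta> / (3 * (M + 1))"
  have \<gamma>: "0 < \<gamma>" "3 * (M * \<gamma>) \<le> \<delta>" using M \<delta> by (auto simp: \<gamma>_def field_simps)
  have "Cauchy S" using lam(3) by (simp add: S_def[abs_def] convergent_Cauchy)
  then obtain m where m: "\<forall>i\<ge>m. \<forall>j\<ge>m. norm (S i - S j) < \<gamma>"
    using \<gamma>(1) by (meson CauchyD)
  \<comment> \<open>\<open>S n - S m\<close> is the sum from \<open>Suc m\<close> on, so the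
    recursion will be started at \<open>Suc m\<close>, which is at least \<open>1\<close> as
    \<open>dist_T_x_bound\<close> demands.\<close>
  have tail: "(\<Sum>k\<in>{Suc m..n}. \<bar>lam (Suc k) - lam k\<bar>) \<le> \<gamma>" if "m \<le> n" for n
  proof -
    have "{1..n} = {1..m} \<union> {Suc m..n}" using that by auto
    hence "S n = S m + (\<Sum>k\<in>{Suc m..n}. \<bar>lam (Suc k) - lam k\<bar>)"
      unfolding S_def by (simp add: sum.union_disjoint)
    thus ?thesis using m[rule_format, of n m] that by auto
  qed
  have "\<forall>\<^sub>F n in sequentially. (\<Prod>k\<in>{Suc m<..n}. 1 - lam k) < \<gamma>"
    using prod_one_minus_tendsto_0[OF lam(1,4)] \<gamma>(1) order_tendstoD(2) by blast
  moreover have "\<forall>\<^sub>F n in sequentially. lam n < \<gamma>" using lam(2) \<gamma>(1) order_tendstoD(2) by blast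
  ultimately have "\<forall>\<^sub>F n in sequentially. Suc m \<le> n \<and> (\<Prod>k\<in>{Suc m<..n}. 1 - lam k) < \<gamma> \<and> lam n < \<gamma>"
    by (intro eventually_conj eventually_ge_at_top)
  then obtain N where N: "\<And>n. N \<le> n \<Longrightarrow>
      Suc m \<le> n \<and> (\<Prod>k\<in>{Suc m<..n}. 1 - lam k) < \<gamma> \<and> lam n < \<gamma>"
    unfolding eventually_sequentially by blast
  show ?thesis
  proof (intro exI[of _ N] allI impI)
    fix n X d C T and f u :: 'a
    assume n: "N \<le> n" and "halpern_iteration X d C T lam f u M"
    interpret halpern_iteration X d C T lam f u M by fact
    have "d (T (x n)) (x n) \<le> (\<Prod>k\<in>{Suc m<..Suc n}. 1 - lam k) * M
      + M * (\<Sum>k\<in>{Suc m..n}. \<bar>lam (Suc k) - lam k\<bar>) + lam (Suc n) * M"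
      using N n by (intro dist_T_x_bound) auto
    also have "\<dots> \<le> \<gamma> * M + M * \<gamma> + \<gamma> * M"
      using N[of "Suc n"] N[OF n] n M tail[of n] by (intro add_mono mult_right_mono mult_left_mono) auto
    also have "\<dots> \<le> \<delta>" using \<gamma>(2) by (simp add: algebra_simps)
    finally show "d (T (x n)) (x n) \<le> \<delta>" .
  qed
qed

lemma halpern_metastable:
  fixes lam :: "nat \<Rightarrow> real" and F :: "nat \<Rightarrow> nat" and M \<epsilon> :: real
  assumes lam: "\<forall>n. lam n \<in> {0..1}" "lam \<longlonglongrightarrow> 0"
    "convergent (\<lambda>N. \<Sum>n=1..N. \<bar>lam (n + 1) - lam n\<bar>)"
    "filterlim (\<lambda>N. \<Sum>n=1..N. lam n) at_top at_top"
    and M: "0 \<le> M" and \<epsilon>: "0 < \<epsilon>"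
  shows "\<exists>K. \<forall>X d C T (f :: 'a) u. halpern_iteration X d C T lam f u M \<longrightarrow> (\<exists>p\<in>C. T p = p) \<longrightarrow>
    (\<exists>n\<le>K. \<forall>i\<in>{n..F n}. \<forall>j\<in>{n..F n}.
      d (halpern X d T lam f u i) (halpern X d T lam f u j) < \<epsilon>)"
proof -
  \<comment> \<open>The squared distance to \<open>p\<close> will be at most \<open>5 * e\<close>,
    while \<open>(\<epsilon> / 2)\<^sup>2 = 6 * e\<close>.\<close>
  define e where "e = \<epsilon>\<^sup>2 / 24"
  have e: "0 < e" using \<epsilon> by (simp add: e_def)
  \<comment> \<open>Hiding the quantifiers over spaces in \<open>R\<close> lets \<open>m\<close> and
    \<open>N\<close> be chosen as functions of the tolerance alone.\<close>
  define R where "R \<delta> k \<longleftrightarrow> (\<forall>X d C T (f :: 'a) u. halpern_iteration X d C T lam f u M \<longrightarrow>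
    d (T (halpern X d T lam f u k)) (halpern X d T lam f u k) \<le> \<delta>)" for \<delta> k
  have "\<exists>m. \<forall>k\<ge>m. lam k * M\<^sup>2 \<le> e \<and> R \<delta> k" if \<delta>: "0 < \<delta>" for \<delta>
  proof -
    obtain m where m: "\<forall>k\<ge>m. R \<delta> k"
      using uniform_asymptotic_regularity[OF lam M \<delta>] unfolding R_def by (rule exE)
    have "(\<lambda>k. lam k * M\<^sup>2) \<longlonglongrightarrow> 0" using tendsto_mult_left_zero[OF lam(2)] .
    hence "\<forall>\<^sub>F k in sequentially. lam k * M\<^sup>2 < e" using e order_tendstoD(2) by blast
    then obtain m' where "\<And>k. m' \<le> k \<Longrightarrow> lam k * M\<^sup>2 < e" unfolding eventually_sequentially by blast
    with m show ?thesis by (intro exI[of _ "max m m'"]) (auto intro: less_imp_le)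
  qed
  then obtain m where m: "\<And>\<delta> k. \<lbrakk>0 < \<delta>; m \<delta> \<le> k\<rbrakk> \<Longrightarrow> lam k * M\<^sup>2 \<le> e \<and> R \<delta> k" by metis
  \<comment> \<open>From \<open>N \<delta>\<close> on, the recursion started at
    \<open>m \<delta>\<close> has forgotten its initial value up to \<open>e\<close>; the window
    will begin there.\<close>
  have "\<exists>N\<ge>m \<delta>. \<forall>n\<ge>N. (\<Prod>k\<in>{m \<delta><..n}. 1 - lam k) * M\<^sup>2 \<le> e" for \<delta>
  proof -
    have "\<forall>\<^sub>F n in sequentially. (\<Prod>k\<in>{m \<delta><..n}. 1 - lam k) * M\<^sup>2 < e"
      using tendsto_mult_left_zero[OF prod_one_minus_tendsto_0[OF lam(1,4)]] e order_tendstoD(2) by blast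
    then obtain N where "\<And>n. N \<le> n \<Longrightarrow> (\<Prod>k\<in>{m \<delta><..n}. 1 - lam k) * M\<^sup>2 < e"
      unfolding eventually_sequentially by blast
    thus ?thesis by (intro exI[of _ "max N (m \<delta>)"]) (auto intro: less_imp_le)
  qed
  then obtain N where N: "\<And>\<delta>. m \<delta> \<le> N \<delta>"
    "\<And>\<delta> n. N \<delta> \<le> n \<Longrightarrow> (\<Prod>k\<in>{m \<delta><..n}. 1 - lam k) * M\<^sup>2 \<le> e"
    by metis
  \<comment> \<open>The next tolerance is so small that a defect of this size, accumulated up to the
    end \<open>F (N \<delta>)\<close> of the window, stays below \<open>e\<close>. The minimum with
    \<open>1\<close> meets the condition \<open>\<eta> \<le> 1\<close> of
    \<open>dist_sq_approx_fixed_point\<close>, and the added \<open>1\<close> keeps the denominator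
    positive.\<close>
  define \<phi> where "\<phi> \<delta> = min 1 (e / ((2 * M + 1) * (F (N \<delta>) + 1)))" for \<delta>
  define \<delta> where "\<delta> j = (\<phi> ^^ j) 1" for j
  have \<phi>: "0 < \<phi> a" "\<phi> a \<le> 1" "F (N a) * ((2 * M + 1) * \<phi> a) \<le> e" for a
  proof -
    let ?c = "(2 * M + 1) * (F (N a) + 1)"
    have c: "0 < ?c" using M by (simp add: add_pos_nonneg add_nonneg_pos)
    show "0 < \<phi> a" using c e unfolding \<phi>_def by simp
    show "\<phi> a \<le> 1" by (simp add: \<phi>_def)
    have "F (N a) * ((2 * M + 1) * \<phi> a) \<le> ?c * \<phi> a" using M \<open>0 < \<phi> a\<close> by (simp add: algebra_simps)
    also have "\<dots> \<le> ?c * (e / ?c)" using c by (intro mult_left_mono) (auto simp: \<phi>_def)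
    also have "\<dots> = e" using c by (metis less_irrefl nonzero_mult_div_cancel_left times_divide_eq_right)
    finally show "F (N a) * ((2 * M + 1) * \<phi> a) \<le> e" .
  qed
  have \<delta>: "0 < \<delta> j" "\<delta> (Suc j) = \<phi> (\<delta> j)" for j using \<phi>(1) by (cases j; simp add: \<delta>_def)+
  obtain k where k: "M\<^sup>2 < real k * e" using e ex_less_of_nat_mult by blast
  show ?thesis
  \<comment> \<open>Which stage succeeds depends on the space, but the candidates are finitely many
    and known beforehand, so their maximum is a uniform bound.\<close>
  proof (rule exI[of _ "Max ((\<lambda>j. N (\<delta> j)) ` {..k})"], intro allI impI)
    fix X d C T and f u :: 'a
    assume iter: "halpern_iteration X d C T lam f u M" and fp: "\<exists>p\<in>C. T p = p"
    interpret halpern_iteration X d C T lam f u M by fact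
    \<comment> \<open>\<open>Inf (A a)\<close> replaces the squared distance from \<open>u\<close> to its projection onto the fixed point set,
      which need not exist: \<open>X\<close> may be incomplete.\<close>
    define A where "A a = (\<lambda>p. (d u p)\<^sup>2) ` {p \<in> C. d p (T p) \<le> a}" for a
    have A_ne: "A a \<noteq> {}" if "0 < a" for a using fp C_subset that by (force simp: A_def)
    have A_nonneg: "0 \<le> v" if "v \<in> A a" for v a using that by (auto simp: A_def)
    have A_le: "v \<le> M\<^sup>2" if "v \<in> A a" for v a
      using that C_diameter start by (auto simp: A_def intro: power_mono)
    have A_bdd: "bdd_below (A a)" for a using A_nonneg by (meson bdd_belowI)
    have Inf_bounds: "0 \<le> Inf (A a)" "Inf (A a) \<le> M\<^sup>2" if a: "0 < a" for a
    proof -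
      show "0 \<le> Inf (A a)" using A_ne[OF a] A_nonneg by (rule cInf_greatest)
      obtain v where "v \<in> A a" using A_ne[OF a] by blast
      thus "Inf (A a) \<le> M\<^sup>2" using cInf_lower[OF _ A_bdd] A_le order_trans by blast
    qed
    obtain j where j: "j < k" "Inf (A (\<delta> (Suc j))) \<le> Inf (A (\<delta> j)) + e"
      using bounded_almost_nonincreasing[of "\<lambda>j. Inf (A (\<delta> j))" "M\<^sup>2" e k] Inf_bounds \<delta> e k
      by blast
    let ?m = "m (\<delta> j)" and ?N = "N (\<delta> j)" and ?\<eta> = "\<delta> (Suc j)"
    obtain v where "v \<in> A ?\<eta>" "v < Inf (A ?\<eta>) + e"
      using cInf_lessD[OF A_ne[OF \<delta>(1)], of "Suc j" "Inf (A ?\<eta>) + e"] e by auto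
    then obtain p where p: "p \<in> C" "d p (T p) \<le> ?\<eta>" "(d u p)\<^sup>2 < Inf (A ?\<eta>) + e"
      by (auto simp: A_def)
    \<comment> \<open>By nonexpansiveness \<open>T (x i)\<close> is itself fixed up to
      \<open>\<delta> j\<close>, so it competes in \<open>A (\<delta> j)\<close>. One
      \<open>e\<close> comes from the near minimality of \<open>p\<close>, the other from the small
      increase of the infimum.\<close>
    have proj: "(d u p)\<^sup>2 \<le> (d u (T (x i)))\<^sup>2 + 2 * e" if "?m \<le> i" for i
    proof -
      have "d (T (x i)) (T (T (x i))) \<le> d (x i) (T (x i))" by (intro T_dist T_in x_in)
      also have "\<dots> \<le> \<delta> j" using m[OF \<delta>(1) that] iter unfolding R_def commute[of "x i"] by blast
      finally have "(d u (T (x i)))\<^sup>2 \<in> A (\<delta> j)" using T_in x_in by (auto simp: A_def)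
      thus ?thesis using cInf_lower[OF _ A_bdd] p(3) j(2) by fastforce
    qed
    have close: "d (x i) p < \<epsilon> / 2" if "i \<in> {?N..F ?N}" for i
    proof -
      have "(d (x i) p)\<^sup>2 \<le> (\<Prod>k\<in>{?m<..i}. 1 - lam k) * M\<^sup>2 + 3 * e + i * ((2 * M + 1) * ?\<eta>)"
        using p \<phi>(2) \<delta>(2) e N(1)[of "\<delta> j"] that m[OF \<delta>(1)] proj
        by (intro dist_sq_approx_fixed_point) auto
      \<comment> \<open>The end of the window enters here: \<open>i \<le> F ?N\<close> caps the
        accumulated defect of \<open>p\<close>.\<close>
      also have "\<dots> \<le> e + 3 * e + F ?N * ((2 * M + 1) * ?\<eta>)"
        using N(2) that M e less_imp_le[OF \<delta>(1)] by (intro add_mono mult_right_mono) auto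
      also have "\<dots> \<le> 5 * e" using \<phi>(3)[of "\<delta> j"] by (simp add: \<delta>(2))
      also have "\<dots> < (\<epsilon> / 2)\<^sup>2" using \<epsilon> by (simp add: e_def power2_eq_square)
      finally show ?thesis using \<epsilon> by (intro power2_less_imp_less[of _ "\<epsilon> / 2"]) auto
    qed
    have pX: "p \<in> X" using p C_subset by blast
    have "d (x i) (x i') < \<epsilon>" if "i \<in> {?N..F ?N}" "i' \<in> {?N..F ?N}" for i i'
      using close[OF that(1)] close[OF that(2)] triangle[OF in_X(1) pX in_X(1), of i i']
      by (simp add: commute[of p])
    moreover have "?N \<le> Max ((\<lambda>j. N (\<delta> j)) ` {..k})" using j(1) by (intro Max_ge) auto
    ultimately show "\<exists>n\<le>Max ((\<lambda>j. N (\<delta> j)) ` {..k}). \<forall>i\<in>{n..F n}. \<forall>j\<in>{n..F n}.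
      d (x i) (x j) < \<epsilon>"
      by (intro exI[of _ ?N]) simp
  qed
qed

lemma ex_metastability_bound:
  fixes lam :: "nat \<Rightarrow> real" and F :: "nat \<Rightarrow> nat" and M \<epsilon> :: real
  assumes lam: "\<forall>n. lam n \<in> {0..1}" "lam \<longlonglongrightarrow> 0"
    "convergent (\<lambda>N. \<Sum>n=1..N. \<bar>lam (n + 1) - lam n\<bar>)"
    "filterlim (\<lambda>N. \<Sum>n=1..N. lam n) at_top at_top"
    and \<epsilon>: "0 < \<epsilon>"
  shows "\<exists>K. halpern_metastability_bound TYPE('a) lam \<epsilon> M F K"
proof -
  \<comment> \<open>\<open>M\<close> may be any real; \<open>\<bar>M\<bar>\<close> is nonnegative
    and still bounds the diameter.\<close>
  obtain K where K: "\<forall>X d C T (f :: 'a) u. halpern_iteration X d C T lam f u \<bar>M\<bar> \<longrightarrow>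
    (\<exists>p\<in>C. T p = p) \<longrightarrow> (\<exists>n\<le>K. \<forall>i\<in>{n..F n}. \<forall>j\<in>{n..F n}.
      d (halpern X d T lam f u i) (halpern X d T lam f u j) < \<epsilon>)"
    using halpern_metastable[OF lam abs_ge_zero \<epsilon>] by (rule exE)
  show ?thesis
    unfolding halpern_metastability_bound_def
  proof (rule exI[of _ K], intro allI impI)
    fix X C :: "'a set" and d T f u
    assume "CAT0_space X d" "geodesically_convex X d C" "\<forall>x\<in>C. \<forall>y\<in>C. d x y \<le> M"
      "nonexpansive_on d C T" "f \<in> C" "u \<in> C" and fp: "\<exists>p\<in>C. T p = p"
    hence "halpern_iteration X d C T lam f u \<bar>M\<bar>"
      using lam(1) abs_ge_self[of M]
      by (intro halpern_iteration.intro halpern_iteration_axioms.intro) force+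
    thus "\<exists>n\<le>K. \<forall>i\<in>{n..F n}. \<forall>j\<in>{n..F n}.
        d (halpern X d T lam f u i) (halpern X d T lam f u j) < \<epsilon>"
      using fp by (rule K[rule_format])
  qed
qed

section \<open>Transfer to spaces of at most continuum size\<close>

text \<open>\<open>B\<close> is closed under both operations in countably many stages. Each stage
  stays within the continuum although \<open>t\<close> ranges over an interval, and so does the
  countable union.\<close>

lemma ex_closed_superset_le_continuum:
  includes cardinal_syntax
  fixes T :: "'a \<Rightarrow> 'a" and g :: "'a \<Rightarrow> 'a \<Rightarrow> real \<Rightarrow> 'a"
  assumes "finite B"
    and C: "B \<subseteq> C" "\<And>x. x \<in> C \<Longrightarrow> T x \<in> C" "\<And>x y t. \<lbrakk>x \<in> C; y \<in> C; t \<in> {0..1}\<rbrakk> \<Longrightarrow> g x y t \<in> C"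
  obtains Y where "B \<subseteq> Y" "Y \<subseteq> C" "\<And>x. x \<in> Y \<Longrightarrow> T x \<in> Y"
    "\<And>x y t. \<lbrakk>x \<in> Y; y \<in> Y; t \<in> {0..1}\<rbrakk> \<Longrightarrow> g x y t \<in> Y" "|Y| \<le>o |UNIV :: real set|"
proof -
  let ?r = "|UNIV :: real set|"
  define G where "G S = S \<union> T ` S \<union> (\<lambda>(x, y, t). g x y t) ` (S \<times> S \<times> {0..1})" for S
  define L where "L n = (G ^^ n) B" for n
  define Y where "Y = (\<Union>n. L n)"
  have L: "L 0 = B" "L (Suc n) = G (L n)" for n by (simp_all add: L_def)
  have "infinite (UNIV :: real set)" "infinite (Field ?r)"
    by (simp_all add: infinite_UNIV_char_0 Field_card_of)
  note r = this card_of_Card_order[of "UNIV :: real set"]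
  have "|G S| \<le>o ?r" if S: "|S| \<le>o ?r" for S
  proof -
    have "|{0..1::real}| \<le>o ?r" by (rule card_of_mono1) simp
    hence "|S \<times> S \<times> {0..1::real}| \<le>o ?r"
      using S r by (intro card_of_Times_ordLeq_infinite_Field)
    thus ?thesis unfolding G_def
      using S r by (intro card_of_Un_ordLeq_infinite_Field)
        (auto intro: ordLeq_transitive[OF card_of_image])
  qed
  moreover have "|B| \<le>o ?r"
    using finite_lepoll_infinite[OF r(1) assms(1)] card_of_ordLeq[of B UNIV]
    unfolding lepoll_def by blast
  ultimately have "|L n| \<le>o ?r" for n by (induction n) (auto simp: L)
  hence card: "|Y| \<le>o ?r" unfolding Y_def
    using iffD1[OF infinite_iff_card_of_nat r(1)]
    by (intro card_of_UNION_ordLeq_infinite[OF r(1)]) simp_all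
  have "G S \<subseteq> C" if "S \<subseteq> C" for S
    using that C(2,3) unfolding G_def by (fastforce simp: subset_iff)
  hence "L n \<subseteq> C" for n
    by (induction n) (simp_all add: L C(1))
  hence "Y \<subseteq> C" by (auto simp: Y_def)
  have mono: "L m \<subseteq> L n" if "m \<le> n" for m n
    using that by (induction rule: dec_induct) (auto simp: L G_def)
  have "T y \<in> Y" if "y \<in> Y" for y
  proof -
    obtain n where "y \<in> L n" using \<open>y \<in> Y\<close> by (auto simp: Y_def)
    hence "T y \<in> L (Suc n)" by (auto simp: L G_def)
    thus ?thesis unfolding Y_def by blast
  qed
  moreover have "g x y t \<in> Y" if xy: "x \<in> Y" "y \<in> Y" and t: "t \<in> {0..1}" for x y t
  proof -
    obtain m n where "x \<in> L m" "y \<in> L n" using xy by (auto simp: Y_def)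
    hence "x \<in> L (max m n)" "y \<in> L (max m n)" using mono max.cobounded1 max.cobounded2 by blast+
    hence "g x y t \<in> L (Suc (max m n))" using t by (force simp: L G_def)
    thus ?thesis unfolding Y_def by blast
  qed
  moreover have "B \<subseteq> Y" using L(1) unfolding Y_def by blast
  ultimately show ?thesis using that \<open>Y \<subseteq> C\<close> card by blast
qed

section \<open>Pulling back a CAT(0) structure along an injection\<close>

text \<open>\<open>h\<close> identifies \<open>A\<close>, possibly of another type, with a subset of
  \<open>X\<close>; closure under geodesic combinations makes that subset a geodesic space.\<close>

locale CAT0_pullback = CAT0_space X d for X :: "'a set" and d +
  fixes h :: "'b \<Rightarrow> 'a" and A :: "'b set"
  assumes inj: "inj_on h A" and into: "h ` A \<subseteq> X"
    and closed: "\<And>a b t. \<lbrakk>a \<in> A; b \<in> A; t \<in> {0..1}\<rbrakk> \<Longrightarrow> geodesic_comb X d (h a) (h b) t \<in> h ` A"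
begin

abbreviation dh :: "'b \<Rightarrow> 'b \<Rightarrow> real" where "dh a b \<equiv> d (h a) (h b)"

lemma geodesic_segment_image:
  assumes "geodesic_segment A dh a b S"
  shows "geodesic_segment X d (h a) (h b) (h ` S)"
proof -
  obtain c where "c ` {0..dh a b} \<subseteq> A" "c 0 = a" "c (dh a b) = b"
      "\<forall>s\<in>{0..dh a b}. \<forall>t\<in>{0..dh a b}. dh (c s) (c t) = \<bar>s - t\<bar>" "S = c ` {0..dh a b}"
    using assms unfolding geodesic_segment_def by blast
  thus ?thesis
    unfolding geodesic_segment_def
    by (intro exI[of _ "h \<circ> c"]) (use into in \<open>auto simp: image_subset_iff\<close>)
qed

text \<open>A geodesic of \<open>X\<close> between two points of the image consists of geodesic
  combinations of its endpoints. It therefore stays in the image and can be pulled back by the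
  inverse of \<open>h\<close>.\<close>

lemma ex_geodesic_segment:
  assumes "a \<in> A" "b \<in> A"
  shows "\<exists>S. geodesic_segment A dh a b S"
proof -
  have ab: "h a \<in> X" "h b \<in> X" using assms into by auto
  obtain S where S: "geodesic_segment X d (h a) (h b) S" using geodesic[OF ab] by blast
  then obtain c where c: "c ` {0..dh a b} \<subseteq> X" "c 0 = h a" "c (dh a b) = h b"
      "\<forall>s\<in>{0..dh a b}. \<forall>t\<in>{0..dh a b}. d (c s) (c t) = \<bar>s - t\<bar>" "S = c ` {0..dh a b}"
    unfolding geodesic_segment_def by blast
  have "c s \<in> h ` A" if s: "s \<in> {0..dh a b}" for s
  proof -
    \<comment> \<open>If \<open>dh a b = 0\<close>, division by zero yields \<open>0\<close>, which
      is the right parameter since then \<open>s = 0\<close>.\<close>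
    have t: "s / dh a b \<in> {0..1}" using s nonneg[of "h a" "h b"]
      by (cases "dh a b = 0") (auto simp: divide_le_eq_1)
    have "d (c 0) (c s) = \<bar>0 - s\<bar>" using c(4) s by (meson atLeastAtMost_iff nonneg order_refl)
    hence "geodesic_comb X d (h a) (h b) (s / dh a b) = c s"
      using s c t by (intro geodesic_comb_eqI[OF ab S]) auto
    thus ?thesis using closed[OF assms t] by simp
  qed
  hence "inv_into A h (c s) \<in> A \<and> h (inv_into A h (c s)) = c s" if "s \<in> {0..dh a b}" for s
    using that by (simp add: inv_into_into f_inv_into_f)
  thus ?thesis
    unfolding geodesic_segment_def
    by (intro exI[of _ "(inv_into A h \<circ> c) ` {0..dh a b}"] exI[of _ "inv_into A h \<circ> c"])
      (use c assms inj in \<open>auto simp: inv_into_f_f\<close>)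
qed

text \<open>Segments of \<open>A\<close> map to segments of \<open>X\<close> with the same
  distances, so the comparison property is inherited.\<close>

sublocale pullback: CAT0_space A dh
proof
  fix p q r S S' x y and p' q' r' x' y' :: "real^2"
  assume "p \<in> A" "q \<in> A" "r \<in> A"
     "geodesic_segment A dh p q S" "geodesic_segment A dh p r S'" "x \<in> S" "y \<in> S'"
     "dist p' q' = dh p q" "dist p' r' = dh p r" "dist q' r' = dh q r"
     "x' \<in> closed_segment p' q'" "dist p' x' = dh p x"
     "y' \<in> closed_segment p' r'" "dist p' y' = dh p y"
  thus "dh x y \<le> dist x' y'"
    using into
    by (intro comparison[of "h p" "h q" "h r" "h ` S" "h ` S'" _ _ p' q' r'])
      (auto intro: geodesic_segment_image)
next
  fix a b c assume "a \<in> A" "b \<in> A" "c \<in> A"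
  thus "dh a c \<le> dh a b + dh b c" using into by (intro triangle) auto
next
  fix a b assume "a \<in> A" "b \<in> A"
  thus "\<exists>S. geodesic_segment A dh a b S" by (rule ex_geodesic_segment)
  have "dh a b = 0 \<longleftrightarrow> h a = h b" using \<open>a \<in> A\<close> \<open>b \<in> A\<close> into by (intro zero) auto
  thus "dh a b = 0 \<longleftrightarrow> a = b" using \<open>a \<in> A\<close> \<open>b \<in> A\<close> inj by (simp add: inj_on_eq_iff)
qed (auto simp: commute)

lemma pullback_geodesic_comb:
  assumes "a \<in> A" "b \<in> A" "t \<in> {0..1}"
  shows "h (geodesic_comb A dh a b t) = geodesic_comb X d (h a) (h b) t"
proof -
  obtain S where S: "geodesic_segment A dh a b S" "geodesic_comb A dh a b t \<in> S"
    "dh a (geodesic_comb A dh a b t) = t * dh a b" using pullback.geodesic_combE[OF assms] .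
  have "h a \<in> X" "h b \<in> X" using assms into by auto
  thus ?thesis
    using geodesic_comb_eqI[OF _ _ geodesic_segment_image[OF S(1)] imageI[OF S(2)] S(3) assms(3)]
    by simp
qed

text \<open>Both claims go through one induction: the conjugated map inverts \<open>h\<close>
  correctly only at iterates known to lie in \<open>A\<close>.\<close>

lemma pullback_halpern:
  assumes T: "\<And>a. a \<in> A \<Longrightarrow> T (h a) \<in> h ` A" and "a \<in> A" "b \<in> A" "\<And>n. lam n \<in> {0..1}"
  shows "halpern A dh (\<lambda>a. inv_into A h (T (h a))) lam a b n \<in> A"
    "h (halpern A dh (\<lambda>a. inv_into A h (T (h a))) lam a b n) = halpern X d T lam (h a) (h b) n"
proof (induction n)
  case (Suc n)
  let ?y = "halpern A dh (\<lambda>a. inv_into A h (T (h a))) lam a b n"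
  have "inv_into A h (T (h ?y)) \<in> A" "h (inv_into A h (T (h ?y))) = T (h ?y)"
    using T[OF Suc(1)] by (auto intro: inv_into_into f_inv_into_f)
  thus "halpern A dh (\<lambda>a. inv_into A h (T (h a))) lam a b (Suc n) \<in> A"
    "h (halpern A dh (\<lambda>a. inv_into A h (T (h a))) lam a b (Suc n)) = halpern X d T lam (h a) (h b) (Suc n)"
    using assms Suc by (auto simp: pullback_geodesic_comb intro!: pullback.geodesic_comb_in)
qed (use assms in auto)

end

text \<open>The data generate a subspace \<open>Y\<close> of at most continuum size inside
  \<open>C\<close>; labelling its points by reals gives an isometric copy with corresponding
  iterates, to which the bound for \<open>TYPE(real)\<close> applies.\<close>

lemma metastability_bound_transfer:
  fixes lam :: "nat \<Rightarrow> real"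
  assumes lam: "\<And>n. lam n \<in> {0..1}" and K: "halpern_metastability_bound TYPE(real) lam \<epsilon> M F K"
  shows "halpern_metastability_bound TYPE('a) lam \<epsilon> M F K"
  unfolding halpern_metastability_bound_def
proof (intro allI impI)
  fix X C :: "'a set" and d T f u
  assume "CAT0_space X d" and C: "geodesically_convex X d C" "\<forall>x\<in>C. \<forall>y\<in>C. d x y \<le> M"
    and T: "nonexpansive_on d C T" and fp: "\<exists>p\<in>C. T p = p" and fu: "f \<in> C" "u \<in> C"
  interpret CAT0_space X d by fact
  obtain p where p: "p \<in> C" "T p = p" using fp by blast
  \<comment> \<open>The fixed point is among the generators so that the map on the copy has one
    too.\<close>
  obtain Y where Y: "{f, u, p} \<subseteq> Y" "Y \<subseteq> C" "\<And>y. y \<in> Y \<Longrightarrow> T y \<in> Y"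
    "\<And>y z t. \<lbrakk>y \<in> Y; z \<in> Y; t \<in> {0..1}\<rbrakk> \<Longrightarrow> geodesic_comb X d y z t \<in> Y"
    and card: "(card_of Y, card_of (UNIV :: real set)) \<in> ordLeq"
  proof (rule ex_closed_superset_le_continuum[where g = "geodesic_comb X d"])
    show "{f, u, p} \<subseteq> C" using p fu by blast
    show "T y \<in> C" if "y \<in> C" for y using T that by (simp add: nonexpansive_on_def)
    show "geodesic_comb X d y z t \<in> C" if "y \<in> C" "z \<in> C" "t \<in> {0..1}" for y z t
      using C(1) that by (simp add: geodesically_convex_def)
  qed simp_all
  obtain g :: "'a \<Rightarrow> real" where g: "inj_on g Y"
    using card unfolding card_of_ordLeq[symmetric] by auto
  define A where "A = g ` Y"
  define h where "h = inv_into Y g"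
  have hA: "h ` A = Y" "inj_on h A" and hg: "\<And>y. y \<in> Y \<Longrightarrow> h (g y) = y"
    using g by (auto simp: A_def h_def inj_on_inv_into)
  have A: "\<And>a. a \<in> A \<Longrightarrow> h a \<in> Y" using hA by blast
  interpret CAT0_pullback X d h A
    by unfold_locales (use hA Y C(1) A in \<open>auto simp: geodesically_convex_def\<close>)
  let ?T = "\<lambda>a. inv_into A h (T (h a))"
  have hT: "?T a \<in> A" "h (?T a) = T (h a)" if "a \<in> A" for a
    using Y(3)[OF A[OF that]] hA(1) by (auto intro: inv_into_into f_inv_into_f)
  have gA: "g f \<in> A" "g u \<in> A" "g p \<in> A" using Y(1) by (auto simp: A_def)
  \<comment> \<open>In the copy the whole carrier \<open>A\<close> plays the part of
    \<open>C\<close>, so closedness is immediate.\<close>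
  have "closedin pullback.mtopology A"
    using closedin_topspace[of pullback.mtopology] by simp
  moreover have "geodesically_convex A dh A"
    using pullback.geodesic_comb_in by (auto simp: geodesically_convex_def)
  moreover have "\<forall>a\<in>A. \<forall>b\<in>A. dh a b \<le> M" using A Y(2) C(2) by blast
  moreover have "nonexpansive_on dh A ?T"
    using hT T A Y(2) unfolding nonexpansive_on_def by (metis subsetD)
  moreover have "?T (g p) = g p"
    using p hg[of p] Y(1) gA(3) hA(2) by (simp add: inv_into_f_eq)
  ultimately have "\<exists>n\<le>K. \<forall>i\<in>{n..F n}. \<forall>j\<in>{n..F n}.
      dh (halpern A dh ?T lam (g f) (g u) i) (halpern A dh ?T lam (g f) (g u) j) < \<epsilon>"
    using gA
    by (intro K[unfolded halpern_metastability_bound_def, rule_format, where X = A and d = dh and C = A]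
      pullback.CAT0_space_axioms bexI[of _ "g p"]) auto
  moreover have "h (halpern A dh ?T lam (g f) (g u) i) = halpern X d T lam f u i" for i
    using pullback_halpern(2)[of T "g f" "g u" lam i] gA lam hg Y(1) Y(3)[OF A] hA(1) by simp
  ultimately show "\<exists>n\<le>K. \<forall>i\<in>{n..F n}. \<forall>j\<in>{n..F n}.
      d (halpern X d T lam f u i) (halpern X d T lam f u j) < \<epsilon>"
    by simp
qed

theorem theorem3p7:
  fixes lam :: "nat \<Rightarrow> real"
  assumes "\<forall>n. lam n \<in> {0..1}"
    and "lam \<longlonglongrightarrow> 0"
    and "convergent (\<lambda>N. \<Sum>n=1..N. \<bar>lam (n + 1) - lam n\<bar>)"
    and "filterlim (\<lambda>N. \<Sum>n=1..N. lam n) at_top at_top"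
  shows "\<forall>\<epsilon>>0. \<forall>(M::real) (F::nat \<Rightarrow> nat).
    (\<exists>K. halpern_metastability_bound TYPE(real) lam \<epsilon> M F K) \<and>
    (\<forall>K. halpern_metastability_bound TYPE(real) lam \<epsilon> M F K \<longrightarrow>
         halpern_metastability_bound TYPE('a) lam \<epsilon> M F K)"
proof (intro allI impI conjI)
  fix \<epsilon> M :: real and F :: "nat \<Rightarrow> nat"
  assume "0 < \<epsilon>"
  thus "\<exists>K. halpern_metastability_bound TYPE(real) lam \<epsilon> M F K"
    by (rule ex_metastability_bound[OF assms])
  fix K
  assume "halpern_metastability_bound TYPE(real) lam \<epsilon> M F K"
  thus "halpern_metastability_bound TYPE('a) lam \<epsilon> M F K"
    by (rule metastability_bound_transfer[OF assms(1)[rule_format]])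
qed

end
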